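(* Let $P$ be a set of pairwise non-attacking rooks in $\{1,\dots,n\}^3$, let $I,J,K\subseteq N=\{1,\dots,n\}$ with $|I|=a,|J|=b,|K|=c$, $T_0=I\times J\times K$, $T_3=I^c\times J^c\times K^c$, let $c_0,c_3$ be the numbers of rooks of $P$ in $T_0,T_3$, and $\operatorname{def}(T_0,T_3)=n^2-(a+b+c)n+ab+bc+ca-c_0-c_3$. Then $$\operatorname{def}(T_0,T_3)=E_z(I\times J\times N)+E_z(I\times J^c\times N)+E_z(I^c\times J^c\times N)-E_x(N\times J^c\times K)-E_y(I\times N\times K^c).$$
   Context: Two rooks are non-attacking if they agree in at most one coordinate. A file of direction $x$ is $\{(t,j,k):t\in N\}$ for fixed $(j,k)$, similarly for $y,z$. For a brick $X$ with full range $N$ in direction $x$, $E_x(X)$ is the number of $x$-directional files in $X$ containing no rook of $P$; $E_y,E_z$ analogously. In the paper's notation, with $T_{1b}=I\times J^c\times K$, $T_{1c}=I\times J\times K^c$, $T_{2ab}=I^c\times J^c\times K$, $T_{2bc}=I\times J^c\times K^c$, the bricks are $T_0\cup T_{1c}$, $T_{1b}\cup T_{2bc}$, $T_{2ab}\cup T_3$, $T_{1b}\cup T_{2ab}$, $T_{1c}\cup T_{2bc}$. *)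

theory Defs
  imports Main
begin

type_synonym cell = "nat \<times> nat \<times> nat"

text \<open>Two rooks are non-attacking if they agree in at most one coordinate. The relation is meant
  for distinct cells and is used below through \<^const>\<open>pairwise\<close>.\<close>

fun non_attacking :: "cell \<Rightarrow> cell \<Rightarrow> bool" where
  "non_attacking (x, y, z) (x', y', z') \<longleftrightarrow>
     of_bool (x = x') + of_bool (y = y') + of_bool (z = z') \<le> (1::nat)"

definition x_file :: "nat \<Rightarrow> nat \<Rightarrow> nat \<Rightarrow> cell set" where
  "x_file n j k = {(t, j, k) | t. t \<in> {1..n}}"

definition y_file :: "nat \<Rightarrow> nat \<Rightarrow> nat \<Rightarrow> cell set" where
  "y_file n i k = {(i, t, k) | t. t \<in> {1..n}}"

definition z_file :: "nat \<Rightarrow> nat \<Rightarrow> nat \<Rightarrow> cell set" where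
  "z_file n i j = {(i, j, t) | t. t \<in> {1..n}}"

definition x_files :: "nat \<Rightarrow> cell set set" where
  "x_files n = {x_file n j k | j k. j \<in> {1..n} \<and> k \<in> {1..n}}"

definition y_files :: "nat \<Rightarrow> cell set set" where
  "y_files n = {y_file n i k | i k. i \<in> {1..n} \<and> k \<in> {1..n}}"

definition z_files :: "nat \<Rightarrow> cell set set" where
  "z_files n = {z_file n i j | i j. i \<in> {1..n} \<and> j \<in> {1..n}}"

text \<open>The numbers \<open>E\<^sub>x(X)\<close>, \<open>E\<^sub>y(X)\<close>, \<open>E\<^sub>z(X)\<close> of files lying in \<open>X\<close> and containing no rook of \<open>P\<close>;
  only intended for bricks \<open>X\<close> with full range in the respective direction.\<close>

definition E_x :: "nat \<Rightarrow> cell set \<Rightarrow> cell set \<Rightarrow> nat" where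
  "E_x n P X = card {F \<in> x_files n. F \<subseteq> X \<and> F \<inter> P = {}}"

definition E_y :: "nat \<Rightarrow> cell set \<Rightarrow> cell set \<Rightarrow> nat" where
  "E_y n P X = card {F \<in> y_files n. F \<subseteq> X \<and> F \<inter> P = {}}"

definition E_z :: "nat \<Rightarrow> cell set \<Rightarrow> cell set \<Rightarrow> nat" where
  "E_z n P X = card {F \<in> z_files n. F \<subseteq> X \<and> F \<inter> P = {}}"

text \<open>The deficiency \<open>def(T\<^sub>0, T\<^sub>3)\<close> of the opposite bricks \<open>T\<^sub>0 = I \<times> J \<times> K\<close> and
  \<open>T\<^sub>3 = I\<^sup>c \<times> J\<^sup>c \<times> K\<^sup>c\<close>, complements being taken in \<open>{1..n}\<close>. It can be negative for general
  arguments, hence is an integer.\<close>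

definition deficiency ::
  "nat \<Rightarrow> cell set \<Rightarrow> nat set \<Rightarrow> nat set \<Rightarrow> nat set \<Rightarrow> int" where
  "deficiency n P I J K =
     (let N = {1..n};
          a = int (card I); b = int (card J); c = int (card K);
          c\<^sub>0 = int (card (P \<inter> (I \<times> J \<times> K)));
          c\<^sub>3 = int (card (P \<inter> ((N - I) \<times> (N - J) \<times> (N - K))))
      in (int n)\<^sup>2 - (a + b + c) * int n + a * b + b * c + c * a - c\<^sub>0 - c\<^sub>3)"

end

theory Submission
  imports Defs
begin

text \<open>Distinct non-attacking rooks never share a file, so the number of empty files in a brick
  with full range in the given direction is the area of its cross-section minus the number of its
  rooks. Substituting this for all five bricks, the areas add up to the polynomial part of the
  deficiency, and the rook counts cancel except for those of \<open>T\<^sub>0\<close> and \<open>T\<^sub>3\<close>.\<close>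

text \<open>One argument for all three directions. \<open>D\<close> indexes all files of the
  direction, \<open>S\<close> (the cross-section of \<open>X\<close>) those lying in
  \<open>X\<close>, and \<open>key\<close> maps a cell to the index of the file through it. The
  occupied files in \<open>X\<close> are indexed by the keys of the rooks in \<open>X\<close>;
  injectivity of \<open>key\<close> on these rooks makes their number that of the rooks.\<close>

lemma card_empty_files:
  fixes line :: "'s \<Rightarrow> 'c set" and key :: "'c \<Rightarrow> 's"
  assumes "finite S" "S \<subseteq> D"
    and sub: "\<And>s. s \<in> D \<Longrightarrow> line s \<subseteq> X \<longleftrightarrow> s \<in> S"
    and line: "\<And>s. s \<in> S \<Longrightarrow> line s = {c \<in> X. key c = s}"
    and nonempty: "\<And>s. s \<in> S \<Longrightarrow> line s \<noteq> {}"
    and key: "key ` X \<subseteq> S" and inj: "inj_on key (P \<inter> X)"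
  shows "int (card {F \<in> line ` D. F \<subseteq> X \<and> F \<inter> P = {}}) = int (card S) - int (card (P \<inter> X))"
proof -
  let ?Q = "key ` (P \<inter> X)"
  have Q: "?Q \<subseteq> S"
    using key by blast
  have "line s \<inter> P = {} \<longleftrightarrow> s \<notin> ?Q" if "s \<in> S" for s
    using line[OF that] by auto
  then have "{F \<in> line ` D. F \<subseteq> X \<and> F \<inter> P = {}} = line ` (S - ?Q)"
    using sub \<open>S \<subseteq> D\<close> by blast
  \<comment> \<open>Files are counted as sets, so distinct indices must give distinct files. A cell
    common to two files has both indices as its key; nonemptiness supplies such a cell.\<close>
  moreover have "inj_on line S"
  proof (rule inj_onI)
    fix s t assume st: "s \<in> S" "t \<in> S" "line s = line t"
    then obtain c where "c \<in> line s" "c \<in> line t"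
      using nonempty[of s] by blast
    then show "s = t"
      unfolding line[OF st(1)] line[OF st(2)] by simp
  qed
  then have "card (line ` (S - ?Q)) = card (S - ?Q)"
    by (intro card_image) (auto intro: inj_on_subset)
  moreover have "card (S - ?Q) = card S - card (P \<inter> X)"
    using Q inj \<open>finite S\<close> by (simp add: card_Diff_subset finite_subset card_image)
  \<comment> \<open>This bound keeps the subtraction on naturals from truncating, so it agrees with
    the integer one.\<close>
  moreover have "card (P \<inter> X) \<le> card S"
    using card_mono[OF \<open>finite S\<close> Q] inj by (simp add: card_image)
  ultimately show ?thesis
    by (simp add: of_nat_diff)
qed

text \<open>Meant for a \<open>key\<close> that forgets one coordinate: distinct cells with equal
  keys then agree in the other two coordinates, so they cannot both be rooks of
  \<open>P\<close>.\<close>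

lemma inj_on_non_attacking:
  assumes "pairwise non_attacking P"
    and "\<And>c d. key c = key d \<Longrightarrow> c \<noteq> d \<Longrightarrow> \<not> non_attacking c d"
  shows "inj_on key (P \<inter> X)"
  using assms unfolding inj_on_def pairwise_def by blast

lemma E_x_brick:
  assumes "pairwise non_attacking P" "B \<subseteq> {1..n}" "C \<subseteq> {1..n}"
  shows "int (E_x n P ({1..n} \<times> B \<times> C)) =
    int (card B) * int (card C) - int (card (P \<inter> ({1..n} \<times> B \<times> C)))"
proof -
  let ?file = "\<lambda>(j, k). x_file n j k" and ?key = "\<lambda>(x, y, z). (y, z)"
  have files: "x_files n = ?file ` ({1..n} \<times> {1..n})"
    unfolding x_files_def by fast
  have file_eq: "x_file n j k = {1..n} \<times> {j} \<times> {k}" for j k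
    unfolding x_file_def by auto
  have "int (card {F \<in> x_files n. F \<subseteq> {1..n} \<times> B \<times> C \<and> F \<inter> P = {}}) =
      int (card (B \<times> C)) - int (card (P \<inter> ({1..n} \<times> B \<times> C)))"
    unfolding files
  proof (rule card_empty_files)
    show "finite (B \<times> C)"
      using assms(2,3) by (simp add: finite_subset)
    show "B \<times> C \<subseteq> {1..n} \<times> {1..n}"
      using assms(2,3) by blast
    \<comment> \<open>The index range forces n \<ge> 1, so the file is nonempty and its inclusion in
      the brick really constrains \<open>s\<close>.\<close>
    show "?file s \<subseteq> {1..n} \<times> B \<times> C \<longleftrightarrow> s \<in> B \<times> C" if "s \<in> {1..n} \<times> {1..n}" for s
      using that unfolding file_eq by (cases s) (auto simp: times_subset_iff)
    show "?file s = {c \<in> {1..n} \<times> B \<times> C. ?key c = s}" if "s \<in> B \<times> C" for s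
      using that unfolding file_eq by (cases s) auto
    show "?file s \<noteq> {}" if "s \<in> B \<times> C" for s
      using that assms(2) unfolding file_eq by (cases s) auto
    show "?key ` ({1..n} \<times> B \<times> C) \<subseteq> B \<times> C"
      by auto
    show "inj_on ?key (P \<inter> ({1..n} \<times> B \<times> C))"
      using assms(1) by (rule inj_on_non_attacking) auto
  qed
  then show ?thesis
    by (simp add: E_x_def card_cartesian_product)
qed

text \<open>The \<open>y\<close> instance of \<open>card_empty_files\<close>: the key forgets the
  middle coordinate.\<close>

lemma E_y_brick:
  assumes "pairwise non_attacking P" "A \<subseteq> {1..n}" "C \<subseteq> {1..n}"
  shows "int (E_y n P (A \<times> {1..n} \<times> C)) =
    int (card A) * int (card C) - int (card (P \<inter> (A \<times> {1..n} \<times> C)))"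
proof -
  let ?file = "\<lambda>(i, k). y_file n i k" and ?key = "\<lambda>(x, y, z). (x, z)"
  have files: "y_files n = ?file ` ({1..n} \<times> {1..n})"
    unfolding y_files_def by fast
  have file_eq: "y_file n i k = {i} \<times> {1..n} \<times> {k}" for i k
    unfolding y_file_def by auto
  have "int (card {F \<in> y_files n. F \<subseteq> A \<times> {1..n} \<times> C \<and> F \<inter> P = {}}) =
      int (card (A \<times> C)) - int (card (P \<inter> (A \<times> {1..n} \<times> C)))"
    unfolding files
  proof (rule card_empty_files)
    show "finite (A \<times> C)"
      using assms(2,3) by (simp add: finite_subset)
    show "A \<times> C \<subseteq> {1..n} \<times> {1..n}"
      using assms(2,3) by blast
    show "?file s \<subseteq> A \<times> {1..n} \<times> C \<longleftrightarrow> s \<in> A \<times> C" if "s \<in> {1..n} \<times> {1..n}" for s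
      using that unfolding file_eq by (cases s) (auto simp: times_subset_iff)
    show "?file s = {c \<in> A \<times> {1..n} \<times> C. ?key c = s}" if "s \<in> A \<times> C" for s
      using that unfolding file_eq by (cases s) auto
    show "?file s \<noteq> {}" if "s \<in> A \<times> C" for s
      using that assms(2) unfolding file_eq by (cases s) auto
    show "?key ` (A \<times> {1..n} \<times> C) \<subseteq> A \<times> C"
      by auto
    show "inj_on ?key (P \<inter> (A \<times> {1..n} \<times> C))"
      using assms(1) by (rule inj_on_non_attacking) auto
  qed
  then show ?thesis
    by (simp add: E_y_def card_cartesian_product)
qed

text \<open>The \<open>z\<close> instance of \<open>card_empty_files\<close>: the key forgets the
  last coordinate.\<close>

lemma E_z_brick:
  assumes "pairwise non_attacking P" "A \<subseteq> {1..n}" "B \<subseteq> {1..n}"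
  shows "int (E_z n P (A \<times> B \<times> {1..n})) =
    int (card A) * int (card B) - int (card (P \<inter> (A \<times> B \<times> {1..n})))"
proof -
  let ?file = "\<lambda>(i, j). z_file n i j" and ?key = "\<lambda>(x, y, z). (x, y)"
  have files: "z_files n = ?file ` ({1..n} \<times> {1..n})"
    unfolding z_files_def by fast
  have file_eq: "z_file n i j = {i} \<times> {j} \<times> {1..n}" for i j
    unfolding z_file_def by auto
  have "int (card {F \<in> z_files n. F \<subseteq> A \<times> B \<times> {1..n} \<and> F \<inter> P = {}}) =
      int (card (A \<times> B)) - int (card (P \<inter> (A \<times> B \<times> {1..n})))"
    unfolding files
  proof (rule card_empty_files)
    show "finite (A \<times> B)"
      using assms(2,3) by (simp add: finite_subset)
    show "A \<times> B \<subseteq> {1..n} \<times> {1..n}"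
      using assms(2,3) by blast
    show "?file s \<subseteq> A \<times> B \<times> {1..n} \<longleftrightarrow> s \<in> A \<times> B" if "s \<in> {1..n} \<times> {1..n}" for s
      using that unfolding file_eq by (cases s) (auto simp: times_subset_iff)
    show "?file s = {c \<in> A \<times> B \<times> {1..n}. ?key c = s}" if "s \<in> A \<times> B" for s
      using that unfolding file_eq by (cases s) auto
    show "?file s \<noteq> {}" if "s \<in> A \<times> B" for s
      using that assms(2) unfolding file_eq by (cases s) auto
    show "?key ` (A \<times> B \<times> {1..n}) \<subseteq> A \<times> B"
      by auto
    show "inj_on ?key (P \<inter> (A \<times> B \<times> {1..n}))"
      using assms(1) by (rule inj_on_non_attacking) auto
  qed
  then show ?thesis
    by (simp add: E_z_def card_cartesian_product)
qed

text \<open>Serves to cut a full-range brick along \<open>I\<close>, \<open>J\<close> or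
  \<open>K\<close> and its complement.\<close>

lemma card_Int_split:
  assumes "finite P" "X \<inter> Y = {}"
  shows "int (card (P \<inter> (X \<union> Y))) = int (card (P \<inter> X)) + int (card (P \<inter> Y))"
proof -
  have "card (P \<inter> X \<union> P \<inter> Y) = card (P \<inter> X) + card (P \<inter> Y)"
    using assms by (intro card_Un_disjoint) auto
  then show ?thesis
    by (simp add: Int_Un_distrib)
qed

theorem theorem6p5:
  fixes n :: nat and P :: "cell set" and N I J K :: "nat set"
  assumes "N = {1..n}"
    and "P \<subseteq> N \<times> N \<times> N"
    and "pairwise non_attacking P"
    and "I \<subseteq> N" and "J \<subseteq> N" and "K \<subseteq> N"
  shows "deficiency n P I J K =
           int (E_z n P (I \<times> J \<times> N)) + int (E_z n P (I \<times> (N - J) \<times> N))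
         + int (E_z n P ((N - I) \<times> (N - J) \<times> N))
         - int (E_x n P (N \<times> (N - J) \<times> K)) - int (E_y n P (I \<times> N \<times> (N - K)))"
proof -
  note N = assms(1) and sub = assms(2) and na = assms(3)
  have fin: "finite P"
    using finite_subset[OF sub] N by simp
  \<comment> \<open>With the three splitting rules below, the rook count of each brick in the
    theorem becomes a sum of counts over octants, that is, products of \<open>I\<close>,
    \<open>J\<close>, \<open>K\<close> or their complements.\<close>
  define r where "r A B C = int (card (P \<inter> (A \<times> B \<times> C)))" for A B C
  have split_x: "r N B C = r I B C + r (N - I) B C" for B C
  proof -
    have "N \<times> B \<times> C = I \<times> B \<times> C \<union> (N - I) \<times> B \<times> C"
      using assms(4) by auto
    then show ?thesis
      unfolding r_def by (elim ssubst) (rule card_Int_split[OF fin], blast)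
  qed
  have split_y: "r A N C = r A J C + r A (N - J) C" for A C
  proof -
    have "A \<times> N \<times> C = A \<times> J \<times> C \<union> A \<times> (N - J) \<times> C"
      using assms(5) by auto
    then show ?thesis
      unfolding r_def by (elim ssubst) (rule card_Int_split[OF fin], blast)
  qed
  have split_z: "r A B N = r A B K + r A B (N - K)" for A B
  proof -
    have "A \<times> B \<times> N = A \<times> B \<times> K \<union> A \<times> B \<times> (N - K)"
      using assms(6) by auto
    then show ?thesis
      unfolding r_def by (elim ssubst) (rule card_Int_split[OF fin], blast)
  qed
  have card_compl: "int (card (N - A)) = int n - int (card A)" if "A \<subseteq> N" for A
  proof -
    have "finite N" "card N = n"
      unfolding N by auto
    then show ?thesis
      using that card_mono[of N A] finite_subset[of A N]
      by (simp add: card_Diff_subset of_nat_diff)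
  qed
  have Ex: "int (E_x n P (N \<times> B \<times> C)) = int (card B) * int (card C) - r N B C"
    if "B \<subseteq> N" "C \<subseteq> N" for B C
    using that E_x_brick[OF na] unfolding N r_def by blast
  have Ey: "int (E_y n P (A \<times> N \<times> C)) = int (card A) * int (card C) - r A N C"
    if "A \<subseteq> N" "C \<subseteq> N" for A C
    using that E_y_brick[OF na] unfolding N r_def by blast
  have Ez: "int (E_z n P (A \<times> B \<times> N)) = int (card A) * int (card B) - r A B N"
    if "A \<subseteq> N" "B \<subseteq> N" for A B
    using that E_z_brick[OF na] unfolding N r_def by blast
  have "deficiency n P I J K =
      (int n)\<^sup>2 - (int (card I) + int (card J) + int (card K)) * int n
      + int (card I) * int (card J) + int (card J) * int (card K) + int (card K) * int (card I)
      - r I J K - r (N - I) (N - J) (N - K)"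
    unfolding deficiency_def r_def N Let_def ..
  \<comment> \<open>Write a, b, c for the three cardinalities. The areas give ab + a(n-b) +
    (n-a)(n-b) - (n-b)c - a(n-c) = n^2 - (a+b+c)n + ab + bc + ca. The three \<open>z\<close> bricks
    cover six octants once each. The \<open>x\<close> and \<open>y\<close> bricks cover four of
    these once each, with opposite sign, leaving only \<open>I \<times> J \<times> K\<close> and
    \<open>(N - I) \<times> (N - J) \<times> (N - K)\<close>.\<close>
  then show ?thesis
    using assms(4-6)
    by (simp add: Ex Ey Ez card_compl split_x split_y split_z algebra_simps power2_eq_square)
qed

end
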